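(* Let $\mathcal{A}$ be a real symmetric weakly diagonally dominated tensor of order $m$ and dimension $n$, where $m$ is even. Then $\mathcal{A}$ has an SOS tensor decomposition.
   Context: A real tensor of order $m$ and dimension $n$ is an array $\mathcal{A}=(a_{i_1\cdots i_m})$ with $i_1,\dots,i_m\in[n]=\{1,\dots,n\}$; it is symmetric if its entries are invariant under permutations of the indices. Its associated form is $f_{\mathcal{A}}(\mathbf{x})=\mathcal{A}\mathbf{x}^m=\sum_{i_1,\dots,i_m\in[n]}a_{i_1\cdots i_m}x_{i_1}\cdots x_{i_m}$. For even $m$, $\mathcal{A}$ has an SOS tensor decomposition if $f_{\mathcal{A}}$ is a finite sum of squares of real polynomials. Write $f=f_{\mathcal{A}}=\sum_{\alpha}f_\alpha\mathbf{x}^\alpha$ with $\alpha\in(\mathbb{N}\cup\{0\})^n$, $|\alpha|=m$. Let $\Omega_f=\{\alpha: f_\alpha\ne 0,\ \alpha\ne m\,\mathbf{e}_i,\ i=1,\dots,n\}$ ($\mathbf{e}_i$ the $i$th unit vector) and $\Delta_f=\{\alpha\in\Omega_f: f_\alpha<0\ \text{or}\ \alpha\notin(2\mathbb{N}\cup\{0\})^n\}$. Put $\Delta_{\mathcal{A}}=\Delta_{f}$; for an index tuple, $(i_1,\dots,i_m)\in\Delta_{\mathcal{A}}$ means that the exponent vector $\alpha$ of the monomial $x_{i_1}\cdots x_{i_m}$ lies in $\Delta_f$. $\mathcal{A}$ is weakly diagonally dominated if, for each $i=1,\dots,n$, $$a_{ii\cdots i}\ \ge\sum_{\substack{(i_2,\dots,i_m)\neq(i,\dots,i)\\(i,i_2,\dots,i_m)\in\Delta_{\mathcal{A}}}}|a_{ii_2\cdots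 i_m}|.$$ *)

theory Defs
  imports "HOL-Library.Poly_Mapping" "HOL-Combinatorics.Permutations" Complex_Main
begin

text \<open>
  A multivariate polynomial is an element of the monoid algebra of exponent vectors: a finitely
  supported map from exponent vectors (themselves finitely supported maps from variable indices to
  exponents) to coefficients, multiplied by the convolution product of \<^type>\<open>poly_mapping\<close>.
\<close>

type_synonym exponent = "nat \<Rightarrow>\<^sub>0 nat"
type_synonym rpoly = "exponent \<Rightarrow>\<^sub>0 real"

definition pvar :: "nat \<Rightarrow> rpoly" where
  "pvar i = Poly_Mapping.single (Poly_Mapping.single i 1) 1"

definition pconst :: "real \<Rightarrow> rpoly" where
  "pconst c = Poly_Mapping.single 0 c"

text \<open>The polynomial ring in the variables with indices \<open>1, \<dots>, n\<close>.\<close>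

definition polys :: "nat \<Rightarrow> rpoly set" where
  "polys n = {p. \<forall>\<alpha> \<in> Poly_Mapping.keys p. Poly_Mapping.keys \<alpha> \<subseteq> {1..n}}"

definition sos_poly :: "nat \<Rightarrow> rpoly \<Rightarrow> bool" where
  "sos_poly n f \<longleftrightarrow> (\<exists>qs. set qs \<subseteq> polys n \<and> f = (\<Sum>q\<leftarrow>qs. q\<^sup>2))"

text \<open>
  A tensor of order \<open>m\<close> and dimension \<open>n\<close> is a function on index tuples, represented as lists;
  only its values on \<open>tuples m n\<close> are ever used.
\<close>

type_synonym tensor = "nat list \<Rightarrow> real"

definition tuples :: "nat \<Rightarrow> nat \<Rightarrow> nat list set" where
  "tuples m n = {is. length is = m \<and> set is \<subseteq> {1..n}}"

definition symmetric_tensor :: "nat \<Rightarrow> nat \<Rightarrow> tensor \<Rightarrow> bool" where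
  "symmetric_tensor m n A \<longleftrightarrow>
     (\<forall>is \<in> tuples m n. \<forall>\<pi>. \<pi> permutes {..<m} \<longrightarrow> A (permute_list \<pi> is) = A is)"

definition tensor_form :: "nat \<Rightarrow> nat \<Rightarrow> tensor \<Rightarrow> rpoly" where
  "tensor_form m n A = (\<Sum>is \<in> tuples m n. pconst (A is) * (\<Prod>i\<leftarrow>is. pvar i))"

definition sos_tensor_decomposition :: "nat \<Rightarrow> nat \<Rightarrow> tensor \<Rightarrow> bool" where
  "sos_tensor_decomposition m n A \<longleftrightarrow> sos_poly n (tensor_form m n A)"

definition Omega :: "nat \<Rightarrow> nat \<Rightarrow> rpoly \<Rightarrow> exponent set" where
  "Omega m n f =
     {\<alpha>. Poly_Mapping.lookup f \<alpha> \<noteq> 0 \<and> (\<forall>i \<in> {1..n}. \<alpha> \<noteq> Poly_Mapping.single i m)}"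

definition Delta :: "nat \<Rightarrow> nat \<Rightarrow> rpoly \<Rightarrow> exponent set" where
  "Delta m n f =
     {\<alpha> \<in> Omega m n f. Poly_Mapping.lookup f \<alpha> < 0 \<or>
                        \<not> (\<forall>i \<in> {1..n}. even (Poly_Mapping.lookup \<alpha> i))}"

text \<open>The exponent vector of the monomial given by the product of the variables in a tuple.\<close>

definition tuple_exponent :: "nat list \<Rightarrow> exponent" where
  "tuple_exponent is = (\<Sum>i\<leftarrow>is. Poly_Mapping.single i 1)"

definition Delta_tensor :: "nat \<Rightarrow> nat \<Rightarrow> tensor \<Rightarrow> nat list set" where
  "Delta_tensor m n A =
     {is \<in> tuples m n. tuple_exponent is \<in> Delta m n (tensor_form m n A)}"

text \<open>In the sum, \<open>js\<close> is the tail \<open>(i\<^sub>2, \<dots>, i\<^sub>m)\<close> of an index tuple starting with \<open>i\<close>.\<close>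

definition weakly_diagonally_dominated :: "nat \<Rightarrow> nat \<Rightarrow> tensor \<Rightarrow> bool" where
  "weakly_diagonally_dominated m n A \<longleftrightarrow>
     (\<forall>i \<in> {1..n}. A (replicate m i) \<ge>
        (\<Sum>js \<in> {js \<in> tuples (m - 1) n.
                  js \<noteq> replicate (m - 1) i \<and> i # js \<in> Delta_tensor m n A}. \<bar>A (i # js)\<bar>))"

end

theory Submission
  imports Defs
begin

text \<open>Each negative or non-even term \<open>a x\<^bsub>i1\<^esub> \<dots> x\<^bsub>im\<^esub>\<close> of the form becomes a sum of squares once
  \<open>\<bar>a\<bar> / m\<close> times \<open>x\<^bsub>i1\<^esub>\<^sup>m + \<dots> + x\<^bsub>im\<^esub>\<^sup>m\<close> is added, by a sums-of-squares version of the
  arithmetic-geometric mean inequality. By symmetry of the tensor the diagonal terms spent in this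
  way add up to \<open>\<bar>a\<bar> x\<^bsub>i1\<^esub>\<^sup>m\<close> per index tuple, which weak diagonal dominance provides. All
  remaining terms are nonnegative multiples of even monomials.\<close>

subsection \<open>The cone of sums of squares\<close>

lemma pconst_0 [simp]: "pconst 0 = 0"
  by (simp add: pconst_def)

lemma pconst_1 [simp]: "pconst 1 = 1"
  by (simp add: pconst_def)

lemma pconst_add: "pconst (a + b) = pconst a + pconst b"
  by (simp add: pconst_def single_add)

lemma pconst_diff: "pconst (a - b) = pconst a - pconst b"
  by (simp add: pconst_def single_diff)

lemma pconst_mult: "pconst (a * b) = pconst a * pconst b"
  by (simp add: pconst_def mult_single)

lemma pconst_sum: "pconst (sum g I) = (\<Sum>i\<in>I. pconst (g i))"
  by (induction I rule: infinite_finite_induct) (simp_all add: pconst_add)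

lemma pconst_of_nat: "pconst (of_nat k) = of_nat k"
  by (induction k) (simp_all add: pconst_add)

lemma pconst_in_polys: "pconst c \<in> polys n"
  by (auto simp: polys_def pconst_def split: if_splits)

lemma pvar_in_polys: "i \<in> {1..n} \<Longrightarrow> pvar i \<in> polys n"
  by (auto simp: polys_def pvar_def)

lemma polys_add:
  assumes "p \<in> polys n" "q \<in> polys n"
  shows "p + q \<in> polys n"
  using assms Poly_Mapping.keys_add[of p q] by (fastforce simp: polys_def)

lemma polys_diff:
  assumes "p \<in> polys n" "q \<in> polys n"
  shows "p - q \<in> polys n"
  using assms keys_diff[of p q] by (fastforce simp: polys_def)

lemma polys_mult:
  assumes "p \<in> polys n" "q \<in> polys n"
  shows "p * q \<in> polys n"
  unfolding polys_def
proof (clarify)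
  fix \<gamma> i
  assume "\<gamma> \<in> Poly_Mapping.keys (p * q)" "i \<in> Poly_Mapping.keys \<gamma>"
  then obtain \<alpha> \<beta> where "\<alpha> \<in> Poly_Mapping.keys p" "\<beta> \<in> Poly_Mapping.keys q" "i \<in> Poly_Mapping.keys (\<alpha> + \<beta>)"
    using keys_mult[of p q] by blast
  then show "i \<in> {1..n}"
    using assms Poly_Mapping.keys_add[of \<alpha> \<beta>] unfolding polys_def by blast
qed

lemma polys_power: "p \<in> polys n \<Longrightarrow> p ^ k \<in> polys n"
  using pconst_in_polys[of 1 n] by (induction k) (auto intro: polys_mult)

lemma polys_prod_list: "(\<And>i. i \<in> set is \<Longrightarrow> g i \<in> polys n) \<Longrightarrow> (\<Prod>i\<leftarrow>is. g i) \<in> polys n"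
  using pconst_in_polys[of 1 n] by (induction "is") (auto intro: polys_mult)

lemma sos_0: "sos_poly n 0"
  unfolding sos_poly_def by (rule exI[of _ "[]"]) simp

lemma sos_square: "q \<in> polys n \<Longrightarrow> sos_poly n (q\<^sup>2)"
  unfolding sos_poly_def by (rule exI[of _ "[q]"]) simp

lemma sos_add:
  assumes "sos_poly n f" "sos_poly n g"
  shows "sos_poly n (f + g)"
proof -
  obtain qs rs where "set qs \<subseteq> polys n" "f = (\<Sum>q\<leftarrow>qs. q\<^sup>2)" "set rs \<subseteq> polys n" "g = (\<Sum>q\<leftarrow>rs. q\<^sup>2)"
    using assms unfolding sos_poly_def by blast
  then show ?thesis
    unfolding sos_poly_def by (intro exI[of _ "qs @ rs"]) simp
qed

lemma sos_sum: "(\<And>i. i \<in> I \<Longrightarrow> sos_poly n (g i)) \<Longrightarrow> sos_poly n (\<Sum>i\<in>I. g i)"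
  by (induction I rule: infinite_finite_induct) (auto intro: sos_0 sos_add)

lemma sos_square_mult:
  assumes "p \<in> polys n" "sos_poly n f"
  shows "sos_poly n (p\<^sup>2 * f)"
proof -
  obtain qs where qs: "set qs \<subseteq> polys n" "f = (\<Sum>q\<leftarrow>qs. q\<^sup>2)"
    using assms unfolding sos_poly_def by blast
  have "p\<^sup>2 * f = (\<Sum>q\<leftarrow>map ((*) p) qs. q\<^sup>2)"
    by (simp add: qs(2) sum_list_const_mult o_def power_mult_distrib)
  moreover have "set (map ((*) p) qs) \<subseteq> polys n"
    using qs(1) assms(1) by (auto intro: polys_mult)
  ultimately show ?thesis
    unfolding sos_poly_def by blast
qed

text \<open>Each square of one factor can be absorbed into the squares of the other, as p^2 q^2 = (p
  q)^2. Nonnegative constants and even monomials thus become admissible multipliers.\<close>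

lemma sos_mult:
  assumes "sos_poly n f" "sos_poly n g"
  shows "sos_poly n (f * g)"
proof -
  obtain qs where qs: "set qs \<subseteq> polys n" "f = (\<Sum>q\<leftarrow>qs. q\<^sup>2)"
    using assms unfolding sos_poly_def by blast
  have "sos_poly n ((\<Sum>q\<leftarrow>qs. q\<^sup>2) * g)"
    using qs(1) by (induction qs) (auto simp: distrib_right intro: sos_0 sos_add sos_square_mult assms(2))
  then show ?thesis
    by (simp add: qs(2))
qed

lemma sos_pconst:
  assumes "c \<ge> 0"
  shows "sos_poly n (pconst c)"
proof -
  have "pconst c = (pconst (sqrt c))\<^sup>2"
    using assms by (simp add: power2_eq_square flip: pconst_mult)
  then show ?thesis
    using sos_square[OF pconst_in_polys] by metis
qed

lemma sos_of_nat: "sos_poly n (of_nat k)"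
  using sos_pconst[of "of_nat k" n] by (simp add: pconst_of_nat)

lemma sos_power: "sos_poly n f \<Longrightarrow> sos_poly n (f ^ k)"
  using sos_of_nat[of n 1] by (induction k) (auto intro: sos_mult)

text \<open>The constant 1/k is nonnegative, so scaling by it stays in the cone. The inequalities
  below can therefore be proved with integer factors and divided at the end.\<close>

lemma sos_cancel_of_nat:
  assumes "sos_poly n (of_nat k * f)" "k > 0"
  shows "sos_poly n f"
proof -
  have "pconst (1 / of_nat k) * of_nat k = 1"
    using assms(2) pconst_mult[of "1 / of_nat k" "of_nat k"] by (simp add: pconst_of_nat)
  then have "pconst (1 / of_nat k) * (of_nat k * f) = f"
    by (simp flip: mult.assoc)
  moreover have "sos_poly n (pconst (1 / of_nat k) * (of_nat k * f))"
    using assms(1) by (intro sos_mult[OF sos_pconst]) simp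
  ultimately show ?thesis
    by metis
qed

subsection \<open>The arithmetic-geometric mean inequality\<close>

text \<open>Factoring \<open>y ^ k - z ^ k\<close> through \<open>y - z\<close> leaves a square
  times a sum of products of powers of y and z. This is the certificate that powers are monotone, as
  Chebyshev's inequality requires.\<close>

lemma sos_power_diff_mult_diff:
  assumes "y \<in> polys n" "z \<in> polys n" "sos_poly n y" "sos_poly n z"
  shows "sos_poly n ((y ^ k - z ^ k) * (y - z))"
proof (cases k)
  case 0
  then show ?thesis
    by (simp add: sos_0)
next
  case (Suc k')
  have "(y ^ k - z ^ k) * (y - z) = (y - z)\<^sup>2 * (\<Sum>p<k. y ^ p * z ^ (k - 1 - p))"
    unfolding Suc by (simp add: diff_power_eq_sum power2_eq_square mult_ac del: power_Suc)
  also have "sos_poly n \<dots>"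
    using assms by (intro sos_square_mult polys_diff sos_sum) (auto intro: sos_mult sos_power)
  finally show ?thesis .
qed

text \<open>Induction on the number of factors: multiply the inequality for the factors other than
  \<open>Y\<^sub>l\<close> by \<open>Y\<^sub>l\<close>, add over \<open>l\<close>, and bound the result by Chebyshev's sum inequality.\<close>

lemma sos_am_gm:
  fixes Y :: "'a \<Rightarrow> rpoly"
  assumes "finite J" "card J = Suc k"
    and "\<And>j. j \<in> J \<Longrightarrow> Y j \<in> polys n" "\<And>j. j \<in> J \<Longrightarrow> sos_poly n (Y j)"
  shows "sos_poly n ((\<Sum>j\<in>J. Y j ^ Suc k) - of_nat (Suc k) * (\<Prod>j\<in>J. Y j))"
  using assms
proof (induction k arbitrary: J)
  case 0
  then obtain j where "J = {j}"
    by (auto simp: card_1_singleton_iff)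
  then show ?case
    by (simp add: sos_0)
next
  case (Suc k)
  define c :: rpoly where "c = of_nat (Suc k)"
  let ?S = "\<lambda>e. \<Sum>j\<in>J. Y j ^ e"
  let ?P = "\<Prod>j\<in>J. Y j"
  have card: "of_nat (card J) = c + 1"
    using Suc.prems(2) by (simp add: c_def)
  have term_sos: "sos_poly n (Y l * ((\<Sum>j\<in>J - {l}. Y j ^ Suc k) - c * (\<Prod>j\<in>J - {l}. Y j)))"
    if "l \<in> J" for l
    unfolding c_def using that Suc.prems by (intro sos_mult Suc.IH) auto
  have term_eq: "Y l * ((\<Sum>j\<in>J - {l}. Y j ^ Suc k) - c * (\<Prod>j\<in>J - {l}. Y j))
      = Y l * ?S (Suc k) - Y l ^ Suc (Suc k) - c * ?P" if "l \<in> J" for l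
  proof -
    have "?S (Suc k) = Y l ^ Suc k + (\<Sum>j\<in>J - {l}. Y j ^ Suc k)" "?P = Y l * (\<Prod>j\<in>J - {l}. Y j)"
      using that Suc.prems(1) by (auto intro: sum.remove prod.remove)
    then show ?thesis
      by (simp add: algebra_simps)
  qed
  have "sos_poly n (\<Sum>l\<in>J. Y l * ?S (Suc k) - Y l ^ Suc (Suc k) - c * ?P)"
    using sos_sum[of J n, OF term_sos] term_eq by simp
  also have "(\<Sum>l\<in>J. Y l * ?S (Suc k) - Y l ^ Suc (Suc k) - c * ?P)
      = ?S 1 * ?S (Suc k) - ?S (Suc (Suc k)) - (c + 1) * (c * ?P)"
    by (simp add: sum_subtractf sum_distrib_right card del: power_Suc)
  finally have mult: "sos_poly n \<dots>" .
  \<comment> \<open>Expanding this double sum over all pairs gives twice the Chebyshev difference;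
    \<open>c + 1\<close> is the number of factors.\<close>
  have "sos_poly n (\<Sum>l\<in>J. \<Sum>j\<in>J. (Y l ^ Suc k - Y j ^ Suc k) * (Y l - Y j))"
    using Suc.prems by (intro sos_sum sos_power_diff_mult_diff)
  also have "(\<Sum>l\<in>J. \<Sum>j\<in>J. (Y l ^ Suc k - Y j ^ Suc k) * (Y l - Y j))
      = (\<Sum>l\<in>J. \<Sum>j\<in>J. Y l ^ Suc (Suc k) + Y j ^ Suc (Suc k) - Y l ^ Suc k * Y j - Y j ^ Suc k * Y l)"
    by (intro sum.cong refl) (simp add: algebra_simps)
  also have "\<dots> = of_nat 2 * ((c + 1) * ?S (Suc (Suc k)) - ?S (Suc k) * ?S 1)"
    by (simp add: sum_subtractf sum.distrib card algebra_simps del: power_Suc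
        flip: sum_distrib_left sum_distrib_right)
  finally have cheb: "sos_poly n ((c + 1) * ?S (Suc (Suc k)) - ?S (Suc k) * ?S 1)"
    by (rule sos_cancel_of_nat) simp
  \<comment> \<open>The products \<open>?S 1 * ?S (Suc k)\<close> cancel, and \<open>c\<close>
    factors out of what remains.\<close>
  have "sos_poly n (of_nat (Suc k) * (?S (Suc (Suc k)) - of_nat (Suc (Suc k)) * ?P))"
    using sos_add[OF mult cheb] by (simp add: c_def algebra_simps del: power_Suc)
  then show ?case
    by (rule sos_cancel_of_nat) simp
qed


text \<open>The factors are the squared variables, which are sums of squares as
  \<open>sos_am_gm\<close> demands. They are indexed by list positions because a variable may occur
  repeatedly.\<close>

lemma sos_am_gm_list:
  assumes "length us = Suc k" "set us \<subseteq> {1..n}"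
  shows "sos_poly n ((\<Sum>i\<leftarrow>us. pvar i ^ (2 * Suc k)) - of_nat (Suc k) * (\<Prod>i\<leftarrow>us. pvar i)\<^sup>2)"
proof -
  have "us ! j \<in> {1..n}" if "j < Suc k" for j
    using assms that nth_mem[of j us] by (metis subsetD)
  then have "sos_poly n ((\<Sum>j\<in>{..<Suc k}. ((pvar (us ! j))\<^sup>2) ^ Suc k)
      - of_nat (Suc k) * (\<Prod>j\<in>{..<Suc k}. (pvar (us ! j))\<^sup>2))"
    by (intro sos_am_gm) (auto intro!: sos_square pvar_in_polys polys_power simp del: atLeastAtMost_iff)
  moreover have "(\<Sum>i\<leftarrow>us. pvar i ^ (2 * Suc k)) = (\<Sum>j\<in>{..<Suc k}. ((pvar (us ! j))\<^sup>2) ^ Suc k)"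
    using assms(1) by (simp add: sum_list_sum_nth atLeast0LessThan power_mult del: power_Suc mult_Suc_right)
  moreover have "(\<Prod>i\<leftarrow>us. pvar i)\<^sup>2 = (\<Prod>j\<in>{..<Suc k}. (pvar (us ! j))\<^sup>2)"
    using assms(1)
    by (simp add: prod.list_conv_set_nth atLeast0LessThan prod_power_distrib del: prod.lessThan_Suc)
  ultimately show ?thesis
    by simp
qed

text \<open>The monomial splits as \<open>U V\<close> into two halves of equal degree; \<open>2 \<bar>U V\<bar> \<le> U\<^sup>2 + V\<^sup>2\<close> reduces the
  claim to the even monomials \<open>U\<^sup>2\<close> and \<open>V\<^sup>2\<close>.\<close>

lemma sos_tuple_am_gm:
  assumes "is \<in> tuples m n" "even m" "m \<ge> 1"
  shows "sos_poly n (pconst \<bar>a\<bar> * (\<Sum>i\<leftarrow>is. pvar i ^ m) + of_nat m * (pconst a * (\<Prod>i\<leftarrow>is. pvar i)))"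
proof -
  obtain k where m: "m = 2 * Suc k"
    using assms(2,3) by (metis Suc_pred dvdE less_eq_Suc_le mult_is_0 not_gr_zero One_nat_def)
  define us vs where "us = take (Suc k) is" and "vs = drop (Suc k) is"
  have is_eq: "is = us @ vs"
    by (simp add: us_def vs_def)
  have len: "length us = Suc k" "length vs = Suc k" and set: "set us \<subseteq> {1..n}" "set vs \<subseteq> {1..n}"
    using assms(1) set_take_subset[of "Suc k" "is"] set_drop_subset[of "Suc k" "is"]
    by (auto simp: us_def vs_def tuples_def m)
  define c :: rpoly where "c = of_nat (Suc k)"
  \<comment> \<open>The sign of a: it turns the cross term of a square into one with the sign of a,
    while s^2 = 1 leaves the squared terms unchanged.\<close>
  define s :: real where "s = (if a \<ge> 0 then 1 else - 1)"
  define U V Su Sv where "U = (\<Prod>i\<leftarrow>us. pvar i)" and "V = (\<Prod>i\<leftarrow>vs. pvar i)"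
    and "Su = (\<Sum>i\<leftarrow>us. pvar i ^ m)" and "Sv = (\<Sum>i\<leftarrow>vs. pvar i ^ m)"
  have ss: "pconst s * pconst s = 1" and as: "pconst \<bar>a\<bar> * pconst s = pconst a"
    by (simp_all add: s_def flip: pconst_mult)
  have "sos_poly n ((Su - c * U\<^sup>2) + (Sv - c * V\<^sup>2))"
    using sos_am_gm_list[OF len(1) set(1)] sos_am_gm_list[OF len(2) set(2)]
    unfolding U_def V_def Su_def Sv_def c_def m by (rule sos_add)
  moreover have "U \<in> polys n" "V \<in> polys n"
    using set unfolding U_def V_def by (auto intro!: polys_prod_list pvar_in_polys)
  then have "sos_poly n (c * (U + pconst s * V)\<^sup>2)"
    unfolding c_def by (intro sos_mult sos_of_nat sos_square polys_add polys_mult pconst_in_polys)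
  ultimately have "sos_poly n (pconst \<bar>a\<bar> * (((Su - c * U\<^sup>2) + (Sv - c * V\<^sup>2)) + c * (U + pconst s * V)\<^sup>2))"
    by (intro sos_mult[OF sos_pconst] sos_add[of n "_ + _"]) auto
  \<comment> \<open>The defect \<open>pconst s * pconst s - 1\<close> is kept explicit so that this
    is a pure ring identity; it vanishes in the next step. In the end 2c equals m.\<close>
  also have "((Su - c * U\<^sup>2) + (Sv - c * V\<^sup>2)) + c * (U + pconst s * V)\<^sup>2
      = Su + Sv + 2 * c * (pconst s * (U * V)) + c * V\<^sup>2 * (pconst s * pconst s - 1)"
    by (simp add: algebra_simps power2_eq_square)
  also have "pconst \<bar>a\<bar> * \<dots> = pconst \<bar>a\<bar> * (Su + Sv) + 2 * c * ((pconst \<bar>a\<bar> * pconst s) * (U * V))"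
    by (simp add: ss algebra_simps)
  finally show ?thesis
    by (simp add: as is_eq U_def V_def Su_def Sv_def c_def m)
qed

subsection \<open>Symmetric tensors\<close>

lemma finite_tuples: "finite (tuples m n)"
  using finite_lists_length_eq[of "{1..n}" m] by (simp add: tuples_def conj_commute)

lemma lookup_tuple_exponent: "Poly_Mapping.lookup (tuple_exponent is) i = count (mset is) i"
  by (induction "is") (auto simp: tuple_exponent_def lookup_add lookup_single)

lemma tuple_exponent_eq_iff: "tuple_exponent is = tuple_exponent js \<longleftrightarrow> mset is = mset js"
  by (metis lookup_tuple_exponent multiset_eqI poly_mapping_eqI)

lemma tuple_exponent_replicate: "tuple_exponent (replicate m i) = Poly_Mapping.single i m"
  by (rule poly_mapping_eqI) (auto simp: lookup_tuple_exponent lookup_single)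

lemma tuple_exponent_eq_single:
  assumes "tuple_exponent is = Poly_Mapping.single i m"
  shows "is = replicate m i"
proof -
  have "mset is = mset (replicate m i)"
    using assms by (simp only: flip: tuple_exponent_eq_iff tuple_exponent_replicate)
  then show ?thesis
    by (metis length_replicate mset_eq_length mset_eq_setD replicate_length_same in_set_replicate)
qed

lemma prod_list_pvar: "(\<Prod>i\<leftarrow>is. pvar i) = Poly_Mapping.single (tuple_exponent is) 1"
  by (induction "is") (simp_all add: tuple_exponent_def pvar_def mult_single)

lemma permute_list_in_tuples:
  assumes "is \<in> tuples m n" "\<pi> permutes {..<m}"
  shows "permute_list \<pi> is \<in> tuples m n"
  using assms by (auto simp: tuples_def)

lemma symmetric_tensor_mset_eq:
  assumes "symmetric_tensor m n A" "is \<in> tuples m n" "js \<in> tuples m n" "mset is = mset js"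
  shows "A is = A js"
proof -
  obtain \<pi> where "\<pi> permutes {..<length js}" "permute_list \<pi> js = is"
    using assms(4) by (rule mset_eq_permutation)
  then show ?thesis
    using assms(1,3) by (auto simp: symmetric_tensor_def tuples_def)
qed

text \<open>The tuples contributing to one monomial are rearrangements of each other and carry the
  same entry. Since their number is positive, coefficient and entry agree in sign, so
  \<open>Delta\<close> can be read off the entries.\<close>

lemma lookup_tensor_form:
  assumes "symmetric_tensor m n A" "is \<in> tuples m n"
  shows "Poly_Mapping.lookup (tensor_form m n A) (tuple_exponent is)
    = of_nat (card {js \<in> tuples m n. mset js = mset is}) * A is"
proof -
  have "Poly_Mapping.lookup (tensor_form m n A) (tuple_exponent is)
      = (\<Sum>js\<in>tuples m n. if mset js = mset is then A js else 0)"
    unfolding tensor_form_def lookup_sum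
    by (intro sum.cong refl) (simp add: prod_list_pvar pconst_def mult_single lookup_single tuple_exponent_eq_iff)
  also have "\<dots> = (\<Sum>js\<in>{js \<in> tuples m n. mset js = mset is}. A js)"
    by (simp add: sum.inter_filter finite_tuples)
  also have "\<dots> = (\<Sum>js\<in>{js \<in> tuples m n. mset js = mset is}. A is)"
    using assms by (intro sum.cong refl) (auto intro: symmetric_tensor_mset_eq)
  finally show ?thesis
    by simp
qed

section \<open>Terms outside Delta\<close>

lemma sos_even_monomial:
  assumes "is \<in> tuples m n" "\<forall>i\<in>{1..n}. even (Poly_Mapping.lookup (tuple_exponent is) i)"
  shows "sos_poly n (\<Prod>i\<leftarrow>is. pvar i)"
proof -
  define \<beta> where "\<beta> = Poly_Mapping.map (\<lambda>e. e div 2) (tuple_exponent is)"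
  have lookup_\<beta>: "Poly_Mapping.lookup \<beta> i = Poly_Mapping.lookup (tuple_exponent is) i div 2" for i
    by (simp add: \<beta>_def Poly_Mapping.map.rep_eq when_def)
  \<comment> \<open>Evenness is assumed only for indices in \<open>{1..n}\<close>. Elsewhere the
    exponent is 0, which is even and also keeps the halved monomial in
    \<open>polys n\<close>.\<close>
  have outside: "Poly_Mapping.lookup (tuple_exponent is) i = 0" if "i \<notin> {1..n}" for i
    using that assms(1) by (auto simp: lookup_tuple_exponent tuples_def count_eq_zero_iff)
  have "\<beta> + \<beta> = tuple_exponent is"
  proof (rule poly_mapping_eqI)
    fix i
    have "even (Poly_Mapping.lookup (tuple_exponent is) i)"
      using assms(2) outside[of i] by (cases "i \<in> {1..n}") auto
    then show "Poly_Mapping.lookup (\<beta> + \<beta>) i = Poly_Mapping.lookup (tuple_exponent is) i"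
      unfolding lookup_add lookup_\<beta> by presburger
  qed
  then have "(\<Prod>i\<leftarrow>is. pvar i) = (Poly_Mapping.single \<beta> 1)\<^sup>2"
    by (simp add: prod_list_pvar power2_eq_square mult_single)
  moreover have "Poly_Mapping.single \<beta> 1 \<in> polys n"
  proof -
    have "i \<in> {1..n}" if "i \<in> Poly_Mapping.keys \<beta>" for i
      using that outside[of i] unfolding in_keys_iff lookup_\<beta> by (metis div_0)
    then show ?thesis
      unfolding polys_def by auto
  qed
  ultimately show ?thesis
    by (simp add: sos_square)
qed

text \<open>A nonzero off-diagonal entry puts its exponent into \<open>Omega\<close>, so staying out
  of \<open>Delta\<close> forces a nonnegative coefficient and even exponents. A zero entry is
  treated apart, since it says nothing about parity.\<close>

lemma sos_term_outside_Delta: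
  assumes sym: "symmetric_tensor m n A"
    and tup: "is \<in> tuples m n"
    and off_diag: "\<And>i. i \<in> {1..n} \<Longrightarrow> is \<noteq> replicate m i"
    and notin: "is \<notin> Delta_tensor m n A"
  shows "sos_poly n (pconst (A is) * (\<Prod>i\<leftarrow>is. pvar i))"
proof (cases "A is = 0")
  case True
  then show ?thesis
    by (simp add: sos_0)
next
  case False
  let ?N = "card {js \<in> tuples m n. mset js = mset is}"
  have "?N > 0"
    using tup by (auto simp: card_gt_0_iff finite_tuples)
  moreover have "Poly_Mapping.lookup (tensor_form m n A) (tuple_exponent is) = of_nat ?N * A is"
    using sym tup by (rule lookup_tensor_form)
  moreover have "tuple_exponent is \<noteq> Poly_Mapping.single i m" if "i \<in> {1..n}" for i
    using off_diag[OF that] tuple_exponent_eq_single by blast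
  ultimately have "A is \<ge> 0" "\<forall>i\<in>{1..n}. even (Poly_Mapping.lookup (tuple_exponent is) i)"
    using notin tup False
    by (auto simp: Delta_tensor_def Delta_def Omega_def mult_less_0_iff)
  then show ?thesis
    using tup by (intro sos_mult sos_pconst sos_even_monomial)
qed

section \<open>Terms in Delta and their diagonal weights\<close>

lemma permute_list_in_Delta_tensor:
  assumes "is \<in> Delta_tensor m n A" "\<pi> permutes {..<m}"
  shows "permute_list \<pi> is \<in> Delta_tensor m n A"
proof -
  have "length is = m"
    using assms(1) by (simp add: Delta_tensor_def tuples_def)
  then have "tuple_exponent (permute_list \<pi> is) = tuple_exponent is"
    using assms(2) by (simp add: tuple_exponent_eq_iff)
  then show ?thesis
    using assms by (simp add: Delta_tensor_def permute_list_in_tuples)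
qed

text \<open>Swapping positions 0 and j is an involution of \<open>Delta_tensor m n A\<close> that
  preserves the entries of A and brings the index at position j to the head.\<close>

lemma sum_Delta_tensor_nth:
  fixes h :: "nat \<Rightarrow> rpoly"
  assumes "symmetric_tensor m n A" "j < m"
  shows "(\<Sum>is\<in>Delta_tensor m n A. pconst \<bar>A is\<bar> * h (is ! j))
       = (\<Sum>is\<in>Delta_tensor m n A. pconst \<bar>A is\<bar> * h (hd is))"
proof -
  define \<tau> where "\<tau> = transpose 0 j"
  have \<tau>: "\<tau> permutes {..<m}"
    unfolding \<tau>_def using assms(2) by (intro permutes_swap_id) auto
  have len: "length is = m" and tup: "is \<in> tuples m n" if "is \<in> Delta_tensor m n A" for "is"
    using that by (auto simp: Delta_tensor_def tuples_def)
  show ?thesis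
  proof (rule sum.reindex_bij_witness[where i = "permute_list \<tau>" and j = "permute_list \<tau>"])
    fix "is"
    assume "is": "is \<in> Delta_tensor m n A"
    have "permute_list (\<tau> \<circ> \<tau>) is = permute_list \<tau> (permute_list \<tau> is)"
      using \<tau> len[OF "is"] by (intro permute_list_compose) simp
    then show "permute_list \<tau> (permute_list \<tau> is) = is"
      by (simp add: \<tau>_def)
    then show "permute_list \<tau> (permute_list \<tau> is) = is" .
    show "permute_list \<tau> is \<in> Delta_tensor m n A"
      using "is" \<tau> by (rule permute_list_in_Delta_tensor)
    then show "permute_list \<tau> is \<in> Delta_tensor m n A" .
    have "permute_list \<tau> is ! 0 = is ! j"
      using \<tau> len[OF "is"] assms(2) by (subst permute_list_nth) (auto simp: \<tau>_def)
    moreover have "permute_list \<tau> is \<noteq> []"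
      using len[OF "is"] assms(2) by (metis length_permute_list list.size(3) not_less_zero)
    moreover have "A (permute_list \<tau> is) = A is"
      using assms(1) tup[OF "is"] \<tau> by (simp add: symmetric_tensor_def)
    ultimately show "pconst \<bar>A (permute_list \<tau> is)\<bar> * h (hd (permute_list \<tau> is)) = pconst \<bar>A is\<bar> * h (is ! j)"
      by (simp add: hd_conv_nth)
  qed
qed

text \<open>By symmetry each position in an index tuple contributes equally to the diagonal weights needed
  for the arithmetic-geometric mean inequality, so all of the weight may be put on the first index.\<close>

lemma sos_Delta_tensor_sum:
  assumes "symmetric_tensor m n A" "even m" "m \<ge> 1"
  shows "sos_poly n ((\<Sum>is\<in>Delta_tensor m n A. pconst \<bar>A is\<bar> * pvar (hd is) ^ m)
    + (\<Sum>is\<in>Delta_tensor m n A. pconst (A is) * (\<Prod>i\<leftarrow>is. pvar i)))"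
    (is "sos_poly n (?E + ?F)")
proof -
  let ?D = "Delta_tensor m n A"
  have len: "length is = m" and tup: "is \<in> tuples m n" if "is \<in> ?D" for "is"
    using that by (auto simp: Delta_tensor_def tuples_def)
  have "(\<Sum>is\<in>?D. pconst \<bar>A is\<bar> * (\<Sum>i\<leftarrow>is. pvar i ^ m))
      = (\<Sum>is\<in>?D. \<Sum>j<m. pconst \<bar>A is\<bar> * pvar (is ! j) ^ m)"
    by (intro sum.cong refl) (simp add: len sum_list_sum_nth atLeast0LessThan sum_distrib_left)
  also have "\<dots> = (\<Sum>j<m. \<Sum>is\<in>?D. pconst \<bar>A is\<bar> * pvar (is ! j) ^ m)"
    by (rule sum.swap)
  also have "\<dots> = of_nat m * ?E"
    using sum_Delta_tensor_nth[OF assms(1), of _ "\<lambda>i. pvar i ^ m"] by simp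
  \<comment> \<open>The m positions yield m copies of \<open>?E\<close>, matching the factor m in
    \<open>sos_tuple_am_gm\<close>, so m can be cancelled.\<close>
  finally have "(\<Sum>is\<in>?D. pconst \<bar>A is\<bar> * (\<Sum>i\<leftarrow>is. pvar i ^ m) + of_nat m * (pconst (A is) * (\<Prod>i\<leftarrow>is. pvar i)))
      = of_nat m * (?E + ?F)"
    by (simp add: sum.distrib sum_distrib_left distrib_left)
  moreover have "sos_poly n (\<Sum>is\<in>?D. pconst \<bar>A is\<bar> * (\<Sum>i\<leftarrow>is. pvar i ^ m)
      + of_nat m * (pconst (A is) * (\<Prod>i\<leftarrow>is. pvar i)))"
    using assms(2,3) tup by (intro sos_sum sos_tuple_am_gm)
  ultimately show ?thesis
    using assms(3) by (auto intro: sos_cancel_of_nat)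
qed

lemma replicate_notin_Delta_tensor:
  assumes "i \<in> {1..n}"
  shows "replicate m i \<notin> Delta_tensor m n A"
  using assms by (auto simp: Delta_tensor_def Delta_def Omega_def tuple_exponent_replicate)

text \<open>Grouping tuples by first index turns the weights into the row sums that appear in weak
  diagonal dominance.\<close>

lemma sum_Delta_tensor_hd:
  fixes h :: "nat \<Rightarrow> rpoly"
  assumes "m \<ge> 1"
  shows "(\<Sum>is\<in>Delta_tensor m n A. pconst \<bar>A is\<bar> * h (hd is))
       = (\<Sum>i\<in>{1..n}. pconst (\<Sum>js\<in>{js \<in> tuples (m - 1) n.
                  js \<noteq> replicate (m - 1) i \<and> i # js \<in> Delta_tensor m n A}. \<bar>A (i # js)\<bar>) * h i)"
proof -
  let ?D = "Delta_tensor m n A"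
  have fin: "finite ?D"
    using finite_tuples[of m n] by (rule finite_subset[rotated]) (auto simp: Delta_tensor_def)
  have tup: "is \<noteq> []" "is \<in> tuples m n" "hd is \<in> {1..n}" if "is \<in> ?D" for "is"
  proof -
    show "is \<noteq> []" "is \<in> tuples m n"
      using that assms by (auto simp: Delta_tensor_def tuples_def)
    then show "hd is \<in> {1..n}"
      using hd_in_set[of "is"] unfolding tuples_def by blast
  qed
  have "(\<Sum>is\<in>?D. pconst \<bar>A is\<bar> * h (hd is))
      = (\<Sum>i\<in>{1..n}. \<Sum>is\<in>{is \<in> ?D. hd is = i}. pconst \<bar>A is\<bar> * h (hd is))"
    using fin tup(3) by (intro sum.group[symmetric]) auto
  also have "\<dots> = (\<Sum>i\<in>{1..n}. pconst (\<Sum>js\<in>{js \<in> tuples (m - 1) n.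
                  js \<noteq> replicate (m - 1) i \<and> i # js \<in> ?D}. \<bar>A (i # js)\<bar>) * h i)"
  proof (rule sum.cong[OF refl])
    fix i
    assume i: "i \<in> {1..n}"
    have rep: "i # replicate (m - 1) i = replicate m i"
      using assms by (cases m) auto
    have "(\<Sum>is\<in>{is \<in> ?D. hd is = i}. pconst \<bar>A is\<bar> * h (hd is))
      = (\<Sum>js\<in>{js \<in> tuples (m - 1) n. js \<noteq> replicate (m - 1) i \<and> i # js \<in> ?D}. pconst \<bar>A (i # js)\<bar> * h i)"
    proof (rule sum.reindex_bij_witness[where i = "\<lambda>js. i # js" and j = tl])
      fix "is"
      assume "is": "is \<in> {is \<in> ?D. hd is = i}"
      then obtain js where js: "is = i # js"
        using tup(1) by (cases "is") auto
      \<comment> \<open>A tail consisting of copies of i would make the whole tuple diagonal, hence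
        outside Delta.\<close>
      have "js \<noteq> replicate (m - 1) i"
        using "is" js rep replicate_notin_Delta_tensor[OF i, of m A] by auto
      then show "tl is \<in> {js \<in> tuples (m - 1) n. js \<noteq> replicate (m - 1) i \<and> i # js \<in> ?D}"
        using "is" js tup(2)[of "is"] by (auto simp: tuples_def)
      show "i # tl is = is" "pconst \<bar>A (i # tl is)\<bar> * h i = pconst \<bar>A is\<bar> * h (hd is)"
        using js by simp_all
    qed auto
    then show "(\<Sum>is\<in>{is \<in> ?D. hd is = i}. pconst \<bar>A is\<bar> * h (hd is))
      = pconst (\<Sum>js\<in>{js \<in> tuples (m - 1) n. js \<noteq> replicate (m - 1) i \<and> i # js \<in> ?D}. \<bar>A (i # js)\<bar>) * h i"
      by (simp add: pconst_sum sum_distrib_right)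
  qed
  finally show ?thesis .
qed

section \<open>Decomposition of the form into three sums of squares\<close>

theorem theorem3p2:
  fixes m n :: nat and A :: tensor
  assumes "m \<ge> 1" and "n \<ge> 1" and "even m"
    and "symmetric_tensor m n A"
    and "weakly_diagonally_dominated m n A"
  shows "sos_tensor_decomposition m n A"
proof -
  let ?T = "tuples m n" and ?D = "Delta_tensor m n A"
  let ?term = "\<lambda>is. pconst (A is) * (\<Prod>i\<leftarrow>is. pvar i)"
  define G where "G = replicate m ` {1..n}"
  define w where "w i = (\<Sum>js\<in>{js \<in> tuples (m - 1) n.
                  js \<noteq> replicate (m - 1) i \<and> i # js \<in> ?D}. \<bar>A (i # js)\<bar>)" for i
  \<comment> \<open>For m = 0 every diagonal tuple would be the empty list; m \<ge> 1 keeps them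
    distinct.\<close>
  have "inj_on (replicate m) {1..n}"
    using assms(1) by (auto simp: inj_on_def)
  then have diag: "sum ?term G = (\<Sum>i\<in>{1..n}. pconst (A (replicate m i)) * pvar i ^ m)"
    unfolding G_def by (subst sum.reindex) (simp_all add: map_replicate prod_list_replicate)
  have disj: "G \<inter> ?D = {}"
    unfolding G_def using replicate_notin_Delta_tensor by blast
  have sub: "G \<union> ?D \<subseteq> ?T"
    by (auto simp: G_def Delta_tensor_def tuples_def split: if_splits)
  then have fin: "finite G" "finite ?D"
    using finite_tuples by (auto intro: finite_subset)
  have "sum ?term ?T = sum ?term (?T - (G \<union> ?D)) + (sum ?term G + sum ?term ?D)"
    using sum.subset_diff[OF sub finite_tuples, of ?term] sum.union_disjoint[OF fin disj, of ?term] by simp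
  \<comment> \<open>The weight \<open>w i\<close> is taken from each diagonal entry and returned as
    the sum over \<open>?D\<close>. Dominance makes the remaining diagonal coefficients nonnegative,
    and the returned weight compensates the terms in \<open>?D\<close>.\<close>
  also have "\<dots> = sum ?term (?T - (G \<union> ?D))
      + ((\<Sum>i\<in>{1..n}. pconst (A (replicate m i) - w i) * pvar i ^ m)
         + ((\<Sum>is\<in>?D. pconst \<bar>A is\<bar> * pvar (hd is) ^ m) + sum ?term ?D))"
    unfolding sum_Delta_tensor_hd[OF assms(1), where h = "\<lambda>i. pvar i ^ m"] w_def[symmetric] diag
    by (simp add: pconst_diff left_diff_distrib sum_subtractf)
  also have "sos_poly n \<dots>"
  proof (rule sos_add[OF _ sos_add[OF _ sos_Delta_tensor_sum[OF assms(4,3,1)]]])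
    show "sos_poly n (sum ?term (?T - (G \<union> ?D)))"
      by (rule sos_sum, rule sos_term_outside_Delta[OF assms(4)]) (auto simp: G_def)
    have "sos_poly n (pvar i ^ m)" if "i \<in> {1..n}" for i
      using assms(3) pvar_in_polys[OF that] by (metis evenE power_mult sos_power sos_square)
    moreover have "A (replicate m i) - w i \<ge> 0" if "i \<in> {1..n}" for i
      using assms(5) that unfolding weakly_diagonally_dominated_def w_def by auto
    ultimately show "sos_poly n (\<Sum>i\<in>{1..n}. pconst (A (replicate m i) - w i) * pvar i ^ m)"
      by (intro sos_sum sos_mult sos_pconst)
  qed
  finally show ?thesis
    unfolding sos_tensor_decomposition_def tensor_form_def .
qed

end
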